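(* Let $\widetilde a$ be a unitary transition amplitude on $\mathcal P$ with coupling constants $c_{n,j}^k$, let $U_n\colon H_n\to H_{n+1}$, $n\ge 1$, be the linear operator determined by $U_n\widehat x_{n,j}=\sum_{k=0}^3 c_{n,j}^k\,\widehat x_{n+1,4j+k}$ for $j=0,1,\ldots,4^{n-1}-1$, and let $\widehat a_n=\sum_{j=0}^{4^{n-1}-1}a(x_{n,j})\,\widehat x_{n,j}\in H_n$ be the amplitude vector. Then for every $n\ge1$: (i) If $v\in H_n$ is a stochastic state vector, then so is $U_nv\in H_{n+1}$. (ii) $U_n\widehat a_n=\widehat a_{n+1}$. (iii) $U_n^*\widehat a_{n+1}=\widehat a_n$.
   Context: For $n=1,2,\ldots$ let $\mathcal P_n=\{x_{n,0},x_{n,1},\ldots,x_{n,4^{n-1}-1}\}$ be a set of $4^{n-1}$ distinct elements, the $\mathcal P_n$ being pairwise disjoint, and let $\mathcal P=\bigcup_n\mathcal P_n$. (In the source, $\mathcal P_n$ is the set of covariant finite posets of cardinality $2n-1$, suitably ordered; only the tree structure matters here.) Write $x\to y$ ("$y$ is an offspring of $x$") if and only if $x=x_{n,j}$ and $y=x_{n+1,4j+k}$ for some $n\ge1$, $0\le j\le 4^{n-1}-1$, $k\in\{0,1,2,3\}$. For each $x\in\mathcal P_n$ there is a unique $n$-path $\omega_1\omega_2\cdots\omega_n$ (that is, $\omega_i\in\mathcal P_i$ and $\omega_i\to\omega_{i+1}$) with $\omega_n=x$. A unitary transition amplitude is a map $\widetilde a\colon\mathcal P\times\mathcal P\to\mathbb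 C$ with $\widetilde a(x,y)=0$ if $x\not\to y$, and $\sum_{y\in\mathcal P}\widetilde a(x,y)=1$ and $\sum_{y\in\mathcal P}|\widetilde a(x,y)|^2=1$ for every $x\in\mathcal P$. Its coupling constants are $c_{n,j}^k=\widetilde a(x_{n,j},x_{n+1,4j+k})$, $k=0,1,2,3$; hence $\sum_{k=0}^3c_{n,j}^k=\sum_{k=0}^3|c_{n,j}^k|^2=1$. The amplitude of $x\in\mathcal P_n$ is $a(x)=\widetilde a(\omega_1,\omega_2)\widetilde a(\omega_2,\omega_3)\cdots\widetilde a(\omega_{n-1},\omega_n)$, where $\omega_1\cdots\omega_n$ is the unique $n$-path ending at $x$ (so $a(x_{1,0})=1$, the empty product). $H_n$ is the Hilbert space of all functions $f\colon\mathcal P_n\to\mathbb C$ with inner product $\langle f,g\rangle=\sum_{x\in\mathcal P_n}\overline{f(x)}g(x)$, and $\widehat x_{n,j}\in H_n$ is the characteristic function of $\{x_{n,j}\}$. $1_n\in H_n$ is the constant function with value $1$ on $\mathcal P_n$. A vector $v\in H_n$ is a stochastic state vector if $\|v\|=\langle v,1_n\rangle=1$. *)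

theory Defs
  imports "HOL-Analysis.Analysis"
begin

text \<open>The vertices form an arbitrary family \<open>x n j\<close> with \<open>n \<ge> 1\<close> and \<open>j < 4 ^ (n - 1)\<close>;
  the values of \<open>x\<close> at other indices are irrelevant.\<close>

definition level :: "(nat \<Rightarrow> nat \<Rightarrow> 'p) \<Rightarrow> nat \<Rightarrow> 'p set" where
  "level x n = x n ` {..<4 ^ (n - 1)}"

definition vertices :: "(nat \<Rightarrow> nat \<Rightarrow> 'p) \<Rightarrow> 'p set" where
  "vertices x = (\<Union>n\<in>{1..}. level x n)"

definition labelling :: "(nat \<Rightarrow> nat \<Rightarrow> 'p) \<Rightarrow> bool" where
  "labelling x \<longleftrightarrow>
     (\<forall>n\<ge>1. inj_on (x n) {..<4 ^ (n - 1)}) \<and> disjoint_family_on (level x) {1..}"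

definition offspring :: "(nat \<Rightarrow> nat \<Rightarrow> 'p) \<Rightarrow> 'p \<Rightarrow> 'p \<Rightarrow> bool" where
  "offspring x y z \<longleftrightarrow>
     (\<exists>n\<ge>1. \<exists>j<4 ^ (n - 1). \<exists>k<4. y = x n j \<and> z = x (n + 1) (4 * j + k))"

text \<open>Lists are indexed from 0, so \<open>w ! i\<close> is the vertex \<open>\<omega>\<^sub>i\<^sub>+\<^sub>1\<close> of the path.\<close>

definition is_path :: "(nat \<Rightarrow> nat \<Rightarrow> 'p) \<Rightarrow> nat \<Rightarrow> 'p list \<Rightarrow> bool" where
  "is_path x n w \<longleftrightarrow> length w = n \<and>
     (\<forall>i<n. w ! i \<in> level x (i + 1)) \<and>
     (\<forall>i<n - 1. offspring x (w ! i) (w ! (i + 1)))"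

definition path_to :: "(nat \<Rightarrow> nat \<Rightarrow> 'p) \<Rightarrow> 'p \<Rightarrow> 'p list" where
  "path_to x y = (THE w. \<exists>n\<ge>1. is_path x n w \<and> last w = y)"

definition unitary_transition_amplitude ::
    "(nat \<Rightarrow> nat \<Rightarrow> 'p) \<Rightarrow> ('p \<Rightarrow> 'p \<Rightarrow> complex) \<Rightarrow> bool" where
  "unitary_transition_amplitude x ta \<longleftrightarrow>
     (\<forall>y\<in>vertices x. \<forall>z\<in>vertices x. \<not> offspring x y z \<longrightarrow> ta y z = 0) \<and>
     (\<forall>y\<in>vertices x. ((\<lambda>z. ta y z) has_sum 1) (vertices x)) \<and>
     (\<forall>y\<in>vertices x. ((\<lambda>z. (cmod (ta y z))\<^sup>2) has_sum 1) (vertices x))"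

definition coupling ::
    "(nat \<Rightarrow> nat \<Rightarrow> 'p) \<Rightarrow> ('p \<Rightarrow> 'p \<Rightarrow> complex) \<Rightarrow> nat \<Rightarrow> nat \<Rightarrow> nat \<Rightarrow> complex" where
  "coupling x ta n j k = ta (x n j) (x (n + 1) (4 * j + k))"

definition amplitude ::
    "(nat \<Rightarrow> nat \<Rightarrow> 'p) \<Rightarrow> ('p \<Rightarrow> 'p \<Rightarrow> complex) \<Rightarrow> 'p \<Rightarrow> complex" where
  "amplitude x ta y =
     (let w = path_to x y in \<Prod>i<length w - 1. ta (w ! i) (w ! (i + 1)))"

text \<open>A complex function on \<open>level x n\<close> is represented by its extension by zero to the whole
  type, so that equality of elements of the space below is plain equality of functions.\<close>

definition hilb :: "(nat \<Rightarrow> nat \<Rightarrow> 'p) \<Rightarrow> nat \<Rightarrow> ('p \<Rightarrow> complex) set" where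
  "hilb x n = {f. \<forall>y. y \<notin> level x n \<longrightarrow> f y = 0}"

definition hinner ::
    "(nat \<Rightarrow> nat \<Rightarrow> 'p) \<Rightarrow> nat \<Rightarrow> ('p \<Rightarrow> complex) \<Rightarrow> ('p \<Rightarrow> complex) \<Rightarrow> complex" where
  "hinner x n f g = (\<Sum>y\<in>level x n. cnj (f y) * g y)"

definition hnorm :: "(nat \<Rightarrow> nat \<Rightarrow> 'p) \<Rightarrow> nat \<Rightarrow> ('p \<Rightarrow> complex) \<Rightarrow> real" where
  "hnorm x n f = sqrt (Re (hinner x n f f))"

definition xhat :: "(nat \<Rightarrow> nat \<Rightarrow> 'p) \<Rightarrow> nat \<Rightarrow> nat \<Rightarrow> 'p \<Rightarrow> complex" where
  "xhat x n j = indicator {x n j}"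

definition const_one :: "(nat \<Rightarrow> nat \<Rightarrow> 'p) \<Rightarrow> nat \<Rightarrow> 'p \<Rightarrow> complex" where
  "const_one x n = indicator (level x n)"

definition stochastic_state ::
    "(nat \<Rightarrow> nat \<Rightarrow> 'p) \<Rightarrow> nat \<Rightarrow> ('p \<Rightarrow> complex) \<Rightarrow> bool" where
  "stochastic_state x n v \<longleftrightarrow>
     v \<in> hilb x n \<and> hnorm x n v = 1 \<and> hinner x n v (const_one x n) = 1"

definition linear_operator ::
    "('p \<Rightarrow> complex) set \<Rightarrow> ('p \<Rightarrow> complex) set \<Rightarrow>
     (('p \<Rightarrow> complex) \<Rightarrow> ('p \<Rightarrow> complex)) \<Rightarrow> bool" where
  "linear_operator V W T \<longleftrightarrow>
     (\<forall>f\<in>V. T f \<in> W) \<and>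
     (\<forall>f\<in>V. \<forall>g\<in>V. T (\<lambda>y. f y + g y) = (\<lambda>y. T f y + T g y)) \<and>
     (\<forall>c. \<forall>f\<in>V. T (\<lambda>y. c * f y) = (\<lambda>y. c * T f y))"

text \<open>The adjoint of \<open>T : hilb x m \<rightarrow> hilb x n\<close>, applied to \<open>g \<in> hilb x n\<close>.\<close>

definition hadjoint ::
    "(nat \<Rightarrow> nat \<Rightarrow> 'p) \<Rightarrow> nat \<Rightarrow> nat \<Rightarrow> (('p \<Rightarrow> complex) \<Rightarrow> ('p \<Rightarrow> complex)) \<Rightarrow>
     ('p \<Rightarrow> complex) \<Rightarrow> ('p \<Rightarrow> complex)" where
  "hadjoint x m n T g =
     (THE h. h \<in> hilb x m \<and> (\<forall>f\<in>hilb x m. hinner x m h f = hinner x n g (T f)))"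

definition amplitude_vector ::
    "(nat \<Rightarrow> nat \<Rightarrow> 'p) \<Rightarrow> ('p \<Rightarrow> 'p \<Rightarrow> complex) \<Rightarrow> nat \<Rightarrow> 'p \<Rightarrow> complex" where
  "amplitude_vector x ta n =
     (\<lambda>y. \<Sum>j<4 ^ (n - 1). amplitude x ta (x n j) * xhat x n j y)"

end

theory Submission imports Defs begin

text \<open>Every vertex of level \<open>n + 1\<close> is \<open>x (n + 1) (4 * j + k)\<close> for exactly one \<open>j\<close> and one \<open>k < 4\<close>,
  and \<open>U n\<close> multiplies the coordinate at \<open>x n j\<close> by the coupling constant on the way to it.
  The offspring sets being disjoint, the columns of \<open>U n\<close> are orthonormal with entries summing
  to one, so \<open>U n\<close> preserves inner products and the pairing with the constant function;
  this gives (i). The amplitude satisfies the same recursion as the coordinates, giving (ii),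
  and (iii) is (ii) combined with \<open>U\<^sup>* U = I\<close>.\<close>

section \<open>Indexing of the vertices\<close>

lemma level_eqI:
  assumes "labelling x" "m \<ge> 1" "n \<ge> 1" "y \<in> level x m" "y \<in> level x n"
  shows "m = n"
proof (rule ccontr)
  assume "m \<noteq> n"
  then have "level x m \<inter> level x n = {}"
    using assms by (auto simp: labelling_def disjoint_family_on_def)
  then show False using assms by blast
qed

lemma vertex_eqD:
  assumes "labelling x" "m \<ge> 1" "n \<ge> 1" "i < 4 ^ (m - 1)" "j < 4 ^ (n - 1)" "x m i = x n j"
  shows "m = n" "i = j"
proof -
  have "x m i \<in> level x m" "x n j \<in> level x n"
    using assms(4,5) by (auto simp: level_def)
  then show "m = n" using level_eqI[OF assms(1-3)] assms(6) by metis
  then show "i = j" using assms by (auto simp: labelling_def inj_on_def)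
qed

text \<open>The labelling is controlled on level \<open>n\<close> only at indices below
  \<open>4 ^ (n - 1)\<close>, so this bound must accompany every appeal to injectivity for an
  offspring.\<close>

lemma offspring_index_less:
  fixes j k n :: nat
  assumes "n \<ge> 1" "j < 4 ^ (n - 1)" "k < 4"
  shows "4 * j + k < 4 ^ n"
proof -
  have "(4::nat) ^ n = 4 * 4 ^ (n - 1)" using assms(1) by (cases n) auto
  then show ?thesis using assms by linarith
qed

text \<open>\<open>offspring\<close> ranges over all labels of its first argument; disjoint levels
  and injectivity within a level leave only the label \<open>n\<close>, \<open>j\<close>.\<close>

lemma offspring_vertex_iff:
  assumes "labelling x" "n \<ge> 1" "j < 4 ^ (n - 1)"
  shows "offspring x (x n j) z \<longleftrightarrow> z \<in> (\<lambda>k. x (n + 1) (4 * j + k)) ` {..<4}"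
proof
  assume "offspring x (x n j) z"
  then obtain n' j' k where *: "n' \<ge> 1" "j' < 4 ^ (n' - 1)" "k < 4" "x n j = x n' j'"
    "z = x (n' + 1) (4 * j' + k)" by (auto simp: offspring_def)
  then have "n = n'" "j = j'"
    using vertex_eqD[OF assms(1,2) *(1) assms(3) *(2)] by auto
  with * show "z \<in> (\<lambda>k. x (n + 1) (4 * j + k)) ` {..<4}" by auto
qed (use assms in \<open>auto simp: offspring_def\<close>)

lemma sum_lessThan_4_mult:
  fixes f :: "nat \<Rightarrow> 'a :: comm_monoid_add"
  shows "(\<Sum>i<4 * n. f i) = (\<Sum>j<n. \<Sum>k<4. f (4 * j + k))"
proof (induction n)
  case (Suc n)
  have "(\<Sum>i<4 * Suc n. f i) = (\<Sum>i<4 * n. f i) + (\<Sum>k<4. f (4 * n + k))"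
    by (simp add: lessThan_Suc numeral_eq_Suc add_ac)
  with Suc show ?case by simp
qed simp

lemma sum_level:
  assumes "labelling x" "n \<ge> 1"
  shows "(\<Sum>y\<in>level x n. f y) = (\<Sum>j<4 ^ (n - 1). f (x n j))"
  unfolding level_def using assms by (subst sum.reindex) (auto simp: labelling_def)

text \<open>Division of the index by 4 groups the next level by parents, so that the four couplings
  of one parent can be summed together.\<close>

lemma sum_level_Suc:
  assumes "labelling x" "n \<ge> 1"
  shows "(\<Sum>y\<in>level x (n + 1). f y)
    = (\<Sum>j<4 ^ (n - 1). \<Sum>k<4. f (x (n + 1) (4 * j + k)))"
proof -
  have "(4::nat) ^ n = 4 * 4 ^ (n - 1)" using assms(2) by (cases n) auto
  then show ?thesis
    using sum_level[OF assms(1), of "n + 1" f] by (simp add: sum_lessThan_4_mult)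
qed

section \<open>Coupling constants\<close>

text \<open>Only four terms of the infinite sum can be nonzero. The value type is general so that
  one argument serves both the complex amplitudes and the real squared moduli.\<close>

lemma coupling_sum_of_has_sum:
  fixes f :: "'p \<Rightarrow> 'a :: {topological_comm_monoid_add, t2_space}"
  assumes "labelling x" "n \<ge> 1" "j < 4 ^ (n - 1)"
    and "(f has_sum s) (vertices x)"
    and "\<And>z. z \<in> vertices x \<Longrightarrow> \<not> offspring x (x n j) z \<Longrightarrow> f z = 0"
  shows "(\<Sum>k<4. f (x (n + 1) (4 * j + k))) = s"
proof -
  let ?g = "\<lambda>k. x (n + 1) (4 * j + k)"
  have lt: "4 * j + k < 4 ^ n" if "k < 4" for k
    using offspring_index_less assms(2,3) that by blast
  have sub: "?g ` {..<4} \<subseteq> vertices x"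
    using lt by (force simp: vertices_def level_def)
  have inj: "inj_on ?g {..<4}"
  proof (rule inj_onI)
    fix k l :: nat
    assume "k \<in> {..<4}" "l \<in> {..<4}" "?g k = ?g l"
    then show "k = l"
      using vertex_eqD(2)[OF assms(1), of "n + 1" "n + 1" "4 * j + k" "4 * j + l"] lt by auto
  qed
  have "(f has_sum s) (vertices x) \<longleftrightarrow> (f has_sum s) (?g ` {..<4})"
    by (rule has_sum_cong_neutral) (use sub assms offspring_vertex_iff in \<open>fastforce+\<close>)
  with assms(4) have "(f has_sum s) (?g ` {..<4})" by simp
  moreover have "(f has_sum sum f (?g ` {..<4})) (?g ` {..<4})"
    by (rule has_sum_finite) simp
  ultimately have "s = sum f (?g ` {..<4})" by (rule has_sum_unique)
  then show ?thesis using inj by (simp add: sum.reindex)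
qed

lemma vertex_in_vertices:
  assumes "n \<ge> 1" "j < 4 ^ (n - 1)"
  shows "x n j \<in> vertices x"
  using assms by (force simp: vertices_def level_def)

lemma coupling_sum:
  assumes "labelling x" "unitary_transition_amplitude x ta" "n \<ge> 1" "j < 4 ^ (n - 1)"
  shows "(\<Sum>k<4. coupling x ta n j k) = 1"
  unfolding coupling_def
  by (rule coupling_sum_of_has_sum[OF assms(1,3,4)])
    (use assms(2) vertex_in_vertices[OF assms(3,4), of x]
      in \<open>auto simp: unitary_transition_amplitude_def\<close>)

lemma coupling_norm_sum:
  assumes "labelling x" "unitary_transition_amplitude x ta" "n \<ge> 1" "j < 4 ^ (n - 1)"
  shows "(\<Sum>k<4. (cmod (coupling x ta n j k))\<^sup>2) = 1"
  unfolding coupling_def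
  by (rule coupling_sum_of_has_sum[OF assms(1,3,4), where f = "\<lambda>z. (cmod (ta (x n j) z))\<^sup>2"])
    (use assms(2) vertex_in_vertices[OF assms(3,4), of x]
      in \<open>auto simp: unitary_transition_amplitude_def\<close>)

section \<open>Paths and amplitudes\<close>

text \<open>Going up one edge replaces the index by its quotient by 4. The induction runs backwards,
  on the distance \<open>d\<close> from the end, because only the endpoint of the path is
  given.\<close>

lemma path_nth:
  assumes "labelling x" "n \<ge> 1" "j < 4 ^ (n - 1)" "is_path x n w" "last w = x n j" "d < n"
  shows "w ! (n - 1 - d) = x (n - d) (j div 4 ^ d)"
  using assms(6)
proof (induction d)
  case 0
  have "w \<noteq> []" "length w = n" using assms by (auto simp: is_path_def)
  with assms(5) show ?case by (simp add: last_conv_nth)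
next
  case (Suc d)
  have "offspring x (w ! (n - 1 - Suc d)) (w ! (n - 1 - Suc d + 1))"
    using assms(4) Suc.prems unfolding is_path_def by auto
  moreover have "n - 1 - Suc d + 1 = n - 1 - d" using Suc.prems by simp
  ultimately obtain m i k where *: "m \<ge> 1" "i < 4 ^ (m - 1)" "k < 4"
    "w ! (n - 1 - Suc d) = x m i" "x (n - d) (j div 4 ^ d) = x (m + 1) (4 * i + k)"
    using Suc by (auto simp: offspring_def)
  \<comment> \<open>Both labels of the common vertex must be known to be in range before they can be
    compared.\<close>
  have "(4::nat) ^ (n - 1) = 4 ^ (n - d - 1) * 4 ^ d"
    using Suc.prems by (simp flip: power_add)
  then have "j div 4 ^ d < 4 ^ (n - d - 1)"
    using assms(3) by (simp add: div_less_iff_less_mult)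
  then have "j div 4 ^ d < 4 ^ (n - d - 1)" "4 * i + k < 4 ^ (m + 1 - 1)" "1 \<le> n - d" "1 \<le> m + 1"
    using offspring_index_less[OF *(1-3)] Suc.prems by auto
  then have "n - d = m + 1" "j div 4 ^ d = 4 * i + k"
    using vertex_eqD[OF assms(1) _ _ _ _ *(5)] by blast+
  moreover from this have "j div 4 ^ Suc d = i"
    using \<open>k < 4\<close> by (simp add: div_mult2_eq mult.commute[of 4 "4 ^ d"])
  moreover have "m = n - Suc d" using \<open>n - d = m + 1\<close> by simp
  ultimately show ?case using *(4) by simp
qed

text \<open>The base-4 digits of \<open>j\<close> record the branches taken along the path; cutting
  off final digits gives the ancestors. List position \<open>i\<close> belongs to level
  \<open>i + 1\<close>.\<close>

definition ancestry :: "(nat \<Rightarrow> nat \<Rightarrow> 'p) \<Rightarrow> nat \<Rightarrow> nat \<Rightarrow> 'p list" where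
  "ancestry x n j = map (\<lambda>i. x (i + 1) (j div 4 ^ (n - 1 - i))) [0..<n]"

lemma is_path_ancestry:
  assumes "n \<ge> 1" "j < 4 ^ (n - 1)"
  shows "is_path x n (ancestry x n j)"
proof -
  have lt: "j div 4 ^ (n - 1 - i) < 4 ^ i" if "i < n" for i
  proof -
    have "(4::nat) ^ (n - 1) = 4 ^ i * 4 ^ (n - 1 - i)"
      using that by (simp flip: power_add)
    then show ?thesis using assms(2) by (simp add: div_less_iff_less_mult)
  qed
  have "offspring x (ancestry x n j ! i) (ancestry x n j ! (i + 1))" if "i < n - 1" for i
  proof -
    \<comment> \<open>\<open>?q\<close> is the index of the lower vertex of the edge: its parent has
      index \<open>?q div 4\<close>, and the branch is \<open>?q mod 4\<close>.\<close>
    let ?q = "j div 4 ^ (n - 1 - (i + 1))"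
    have "n - 1 - i = Suc (n - 1 - (i + 1))" using that by simp
    then have "j div 4 ^ (n - 1 - i) = ?q div 4"
      by (simp only: power_Suc2 div_mult2_eq)
    moreover have "4 * (?q div 4) + ?q mod 4 = ?q" by simp
    ultimately show ?thesis
      unfolding offspring_def ancestry_def using that lt[of i]
      by (intro exI[of _ "i + 1"] conjI exI[of _ "?q div 4"] exI[of _ "?q mod 4"]) auto
  qed
  then show ?thesis using lt by (auto simp: is_path_def ancestry_def level_def)
qed

text \<open>The description in \<open>path_to\<close> leaves the length open. Disjoint levels force
  it to be \<open>n\<close>, and then \<open>path_nth\<close> fixes every entry.\<close>

lemma path_to_vertex:
  assumes "labelling x" "n \<ge> 1" "j < 4 ^ (n - 1)"
  shows "path_to x (x n j) = ancestry x n j"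
  unfolding path_to_def
proof (rule the_equality)
  have "last (ancestry x n j) = x n j"
    using assms(2) by (simp add: ancestry_def last_conv_nth)
  then show "\<exists>m\<ge>1. is_path x m (ancestry x n j) \<and> last (ancestry x n j) = x n j"
    using is_path_ancestry[OF assms(2,3)] assms(2) by blast
next
  fix w
  assume "\<exists>m\<ge>1. is_path x m w \<and> last w = x n j"
  then obtain m where m: "m \<ge> 1" "is_path x m w" "last w = x n j" by blast
  then have "w \<noteq> []" "length w = m" by (auto simp: is_path_def)
  then have "last w \<in> level x m"
    using m by (auto simp: is_path_def last_conv_nth dest!: spec[of _ "m - 1"])
  moreover have "last w \<in> level x n" using m(3) assms by (auto simp: level_def)
  ultimately have "m = n" using level_eqI assms m(1) by metis
  show "w = ancestry x n j"
  proof (rule nth_equalityI)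
    show "length w = length (ancestry x n j)"
      using \<open>m = n\<close> \<open>length w = m\<close> by (simp add: ancestry_def)
    fix i
    assume "i < length w"
    then show "w ! i = ancestry x n j ! i"
      using path_nth[OF assms, of w "n - 1 - i"] m \<open>m = n\<close> \<open>length w = m\<close>
      by (simp add: ancestry_def)
  qed
qed

text \<open>The path to an offspring is the path to its parent with one vertex appended, so the
  product gains one factor.\<close>

lemma amplitude_offspring:
  assumes "labelling x" "n \<ge> 1" "j < 4 ^ (n - 1)" "k < 4"
  shows "amplitude x ta (x (n + 1) (4 * j + k)) = amplitude x ta (x n j) * coupling x ta n j k"
proof -
  have lt: "4 * j + k < 4 ^ n" using offspring_index_less assms by blast
  have dv: "(4 * j + k) div 4 ^ (n - i) = j div 4 ^ (n - 1 - i)" if "i < n" for i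
  proof -
    have "n - i = Suc (n - 1 - i)" using that by simp
    then show ?thesis using assms(4) by (simp only: power_Suc div_mult2_eq) simp
  qed
  have anc: "ancestry x (n + 1) (4 * j + k) = ancestry x n j @ [x (n + 1) (4 * j + k)]"
    by (rule nth_equalityI) (auto simp: ancestry_def nth_append dv less_Suc_eq)
  have len: "length (ancestry x n j) = n" by (simp add: ancestry_def)
  have last: "ancestry x n j ! (n - 1) = x n j"
    using assms(2) by (simp add: ancestry_def)
  \<comment> \<open>Writing \<open>n\<close> as a successor splits off the last factor of the
    product.\<close>
  obtain m where m: "n = Suc m" using assms(2) by (cases n) auto
  show ?thesis
    using path_to_vertex[OF assms(1-3)] path_to_vertex[OF assms(1), of "n + 1" "4 * j + k"]
      lt anc len last m
    by (simp add: amplitude_def Let_def coupling_def nth_append)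
qed

section \<open>The evolution operator in coordinates\<close>

lemma finite_level: "finite (level x n)"
  by (simp add: level_def)

lemma xhat_in_hilb:
  assumes "j < 4 ^ (n - 1)"
  shows "xhat x n j \<in> hilb x n"
  using assms by (auto simp: hilb_def xhat_def level_def indicator_def)

lemma xhat_vertex:
  assumes "labelling x" "n \<ge> 1" "i < 4 ^ (n - 1)" "j < 4 ^ (n - 1)"
  shows "xhat x n i (x n j) = (if j = i then 1 else 0)"
  using vertex_eqD(2)[OF assms(1,2,2,4,3)] by (auto simp: xhat_def indicator_def)

lemma xhat_offspring:
  assumes "labelling x" "n \<ge> 1" "i < 4 ^ (n - 1)" "j < 4 ^ (n - 1)" "l < 4" "k < 4"
  shows "xhat x (n + 1) (4 * i + l) (x (n + 1) (4 * j + k)) = (if j = i \<and> k = l then 1 else 0)"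
proof -
  have "4 * i + l < 4 ^ n" "4 * j + k < 4 ^ n"
    using offspring_index_less assms by auto
  moreover have "4 * j + k = 4 * i + l \<longleftrightarrow> j = i \<and> k = l"
    using assms(5,6) by presburger
  ultimately show ?thesis
    using xhat_vertex[OF assms(1), of "n + 1" "4 * i + l" "4 * j + k"] by simp
qed

lemma xhat_expansion_vertex:
  assumes "labelling x" "n \<ge> 1" "j < 4 ^ (n - 1)"
  shows "(\<Sum>i<4 ^ (n - 1). c i * xhat x n i (x n j)) = c j"
proof -
  have "(\<Sum>i<4 ^ (n - 1). c i * xhat x n i (x n j))
      = (\<Sum>i<4 ^ (n - 1). if j = i then c i else 0)"
    by (rule sum.cong) (use assms in \<open>simp_all add: xhat_vertex[OF assms(1,2) _ assms(3)]\<close>)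
  then show ?thesis using assms(3) by simp
qed

lemma hilb_expansion:
  assumes "labelling x" "n \<ge> 1" "f \<in> hilb x n"
  shows "f = (\<lambda>y. \<Sum>j<4 ^ (n - 1). f (x n j) * xhat x n j y)"
proof
  fix y
  show "f y = (\<Sum>j<4 ^ (n - 1). f (x n j) * xhat x n j y)"
  proof (cases "y \<in> level x n")
    case True
    then show ?thesis using xhat_expansion_vertex[OF assms(1,2)] by (auto simp: level_def)
  next
    case False
    then have "f y = 0" "\<And>j. j < 4 ^ (n - 1) \<Longrightarrow> xhat x n j y = 0"
      using assms(3) xhat_in_hilb[of _ n x] by (auto simp: hilb_def)
    then show ?thesis by simp
  qed
qed

lemma linear_operator_sum:
  assumes T: "linear_operator (hilb x m) (hilb x n) T" and "finite I"
    and "\<And>i. i \<in> I \<Longrightarrow> f i \<in> hilb x m"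
  shows "T (\<lambda>y. \<Sum>i\<in>I. c i * f i y) = (\<lambda>y. \<Sum>i\<in>I. c i * T (f i) y)"
  using assms(2,3)
proof (induction I)
  case empty
  \<comment> \<open>That \<open>T\<close> maps zero to zero comes from homogeneity with scalar
    0.\<close>
  have "(\<lambda>y. 0) \<in> hilb x m" by (simp add: hilb_def)
  moreover have "\<And>c f. f \<in> hilb x m \<Longrightarrow> T (\<lambda>y. c * f y) = (\<lambda>y. c * T f y)"
    using T by (simp add: linear_operator_def)
  from this[of "\<lambda>y. 0" 0] calculation show ?case by simp
next
  case (insert i I)
  have "(\<lambda>y. c i * f i y) \<in> hilb x m" "(\<lambda>y. \<Sum>i\<in>I. c i * f i y) \<in> hilb x m"
    using insert.prems by (auto simp: hilb_def)
  then have "T (\<lambda>y. c i * f i y + (\<Sum>i\<in>I. c i * f i y))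
      = (\<lambda>y. T (\<lambda>y. c i * f i y) y + T (\<lambda>y. \<Sum>i\<in>I. c i * f i y) y)"
    using T by (simp add: linear_operator_def)
  also have "\<dots> = (\<lambda>y. c i * T (f i) y + (\<Sum>i\<in>I. c i * T (f i) y))"
    using insert T by (simp add: linear_operator_def)
  finally show ?case using insert.hyps by simp
qed

text \<open>A vertex of level \<open>n + 1\<close> has a single parent, so only one basis vector of
  \<open>hilb x n\<close> contributes there. All later computations use this pointwise form.\<close>

lemma evolution_vertex:
  assumes lab: "labelling x" and n: "n \<ge> 1"
    and T: "linear_operator (hilb x n) (hilb x (n + 1)) T"
    and Tx: "\<And>j. j < 4 ^ (n - 1) \<Longrightarrow>
      T (xhat x n j) = (\<lambda>y. \<Sum>k<4. coupling x ta n j k * xhat x (n + 1) (4 * j + k) y)"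
    and f: "f \<in> hilb x n" and jk: "j < 4 ^ (n - 1)" "k < 4"
  shows "T f (x (n + 1) (4 * j + k)) = coupling x ta n j k * f (x n j)"
proof -
  let ?y = "x (n + 1) (4 * j + k)"
  have "T f = (\<lambda>y. \<Sum>i<4 ^ (n - 1). f (x n i) * T (xhat x n i) y)"
    by (subst hilb_expansion[OF lab n f], rule linear_operator_sum[OF T])
      (auto intro: xhat_in_hilb)
  then have "T f ?y = (\<Sum>i<4 ^ (n - 1). f (x n i) * T (xhat x n i) ?y)" by simp
  also have "\<dots> = (\<Sum>i<4 ^ (n - 1). if j = i then f (x n i) * coupling x ta n i k else 0)"
  proof (rule sum.cong)
    fix i :: nat
    assume i: "i \<in> {..<4 ^ (n - 1)}"
    \<comment> \<open>\<open>4 * i + l\<close> determines \<open>i\<close> and \<open>l\<close>, so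
      only the term with \<open>i = j\<close> and \<open>l = k\<close> survives at
      \<open>?y\<close>.\<close>
    have "T (xhat x n i) ?y
        = (\<Sum>l<4. if k = l then (if j = i then coupling x ta n i l else 0) else 0)"
      unfolding Tx[OF i[unfolded lessThan_iff]]
      by (rule sum.cong) (use i jk xhat_offspring[OF lab n, of i j _ k] in auto)
    also have "\<dots> = (if j = i then coupling x ta n i k else 0)" using jk by simp
    finally show "f (x n i) * T (xhat x n i) ?y
        = (if j = i then f (x n i) * coupling x ta n i k else 0)" by simp
  qed simp
  also have "\<dots> = coupling x ta n j k * f (x n j)" using jk by simp
  finally show ?thesis .
qed

text \<open>Uniqueness: testing against indicators of single vertices recovers the values on the
  level, and off it both functions vanish by the extension by zero.\<close>

lemma hadjoint_eqI:
  assumes "h \<in> hilb x m" "\<And>f. f \<in> hilb x m \<Longrightarrow> hinner x m h f = hinner x n g (T f)"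
  shows "hadjoint x m n T g = h"
  unfolding hadjoint_def
proof (rule the_equality)
  show "h \<in> hilb x m \<and> (\<forall>f\<in>hilb x m. hinner x m h f = hinner x n g (T f))"
    using assms by blast
next
  fix h'
  assume h': "h' \<in> hilb x m \<and> (\<forall>f\<in>hilb x m. hinner x m h' f = hinner x n g (T f))"
  show "h' = h"
  proof
    fix y
    show "h' y = h y"
    proof (cases "y \<in> level x m")
      case True
      then have "indicator {y} \<in> hilb x m" by (auto simp: hilb_def indicator_def)
      then have "hinner x m h' (indicator {y}) = hinner x m h (indicator {y})"
        using assms(2) h' by simp
      moreover have "hinner x m u (indicator {y}) = cnj (u y)" for u
      proof -
        have "hinner x m u (indicator {y}) = (\<Sum>z\<in>level x m. if z = y then cnj (u z) else 0)"
          unfolding hinner_def by (rule sum.cong) (auto simp: indicator_def)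
        then show ?thesis using True finite_level[of x m] by simp
      qed
      ultimately show ?thesis by simp
    next
      case False
      then show ?thesis using h' assms(1) by (auto simp: hilb_def)
    qed
  qed
qed

lemma amplitude_vector_in_hilb: "amplitude_vector x ta n \<in> hilb x n"
  using xhat_in_hilb[of _ n x] by (auto simp: hilb_def amplitude_vector_def)

lemma amplitude_vector_vertex:
  assumes "labelling x" "n \<ge> 1" "j < 4 ^ (n - 1)"
  shows "amplitude_vector x ta n (x n j) = amplitude x ta (x n j)"
  unfolding amplitude_vector_def by (rule xhat_expansion_vertex[OF assms])

text \<open>Quotient and remainder by 4 reach every vertex of the level, so equality can be tested
  on the coordinates that \<open>evolution_vertex\<close> computes.\<close>

lemma hilb_Suc_eqI:
  assumes "n \<ge> 1" "f \<in> hilb x (n + 1)" "g \<in> hilb x (n + 1)"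
    and "\<And>j k. j < 4 ^ (n - 1) \<Longrightarrow> k < 4 \<Longrightarrow>
      f (x (n + 1) (4 * j + k)) = g (x (n + 1) (4 * j + k))"
  shows "f = g"
proof
  fix y
  show "f y = g y"
  proof (cases "y \<in> level x (n + 1)")
    case True
    then obtain i where i: "i < 4 ^ n" "y = x (n + 1) i" by (auto simp: level_def)
    have "(4::nat) ^ n = 4 ^ (n - 1) * 4" using assms(1) by (cases n) auto
    then have "i div 4 < 4 ^ (n - 1)" using i by (simp add: div_less_iff_less_mult)
    then show ?thesis using i assms(4)[of "i div 4" "i mod 4"] by simp
  next
    case False
    then show ?thesis using assms(2,3) by (auto simp: hilb_def)
  qed
qed

theorem theorem3p3:
  fixes x :: "nat \<Rightarrow> nat \<Rightarrow> 'p"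
    and ta :: "'p \<Rightarrow> 'p \<Rightarrow> complex"
    and U :: "nat \<Rightarrow> ('p \<Rightarrow> complex) \<Rightarrow> ('p \<Rightarrow> complex)"
    and n :: nat
  assumes "labelling x"
    and "unitary_transition_amplitude x ta"
    and "\<And>m. m \<ge> 1 \<Longrightarrow> linear_operator (hilb x m) (hilb x (m + 1)) (U m)"
    and "\<And>m j. m \<ge> 1 \<Longrightarrow> j < 4 ^ (m - 1) \<Longrightarrow>
           U m (xhat x m j) = (\<lambda>y. \<Sum>k<4. coupling x ta m j k * xhat x (m + 1) (4 * j + k) y)"
    and "n \<ge> 1"
  shows "(\<forall>v. stochastic_state x n v \<longrightarrow> stochastic_state x (n + 1) (U n v)) \<and>
         U n (amplitude_vector x ta n) = amplitude_vector x ta (n + 1) \<and>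
         hadjoint x n (n + 1) (U n) (amplitude_vector x ta (n + 1)) = amplitude_vector x ta n"
proof -
  note lab = assms(1) and uta = assms(2) and n = assms(5)
  note T = assms(3)[OF n]
  have ev: "U n f (x (n + 1) (4 * j + k)) = coupling x ta n j k * f (x n j)"
    if "f \<in> hilb x n" "j < 4 ^ (n - 1)" "k < 4" for f j k
    by (rule evolution_vertex[OF lab n T assms(4)[OF n] that])
  have inner: "hinner x (n + 1) (U n f) (U n g) = hinner x n f g"
    if "f \<in> hilb x n" "g \<in> hilb x n" for f g
  proof -
    \<comment> \<open>Each coupling occurs once conjugated and once plain, giving its squared
      modulus; for fixed \<open>j\<close> these sum to 1.\<close>
    have "hinner x (n + 1) (U n f) (U n g) = (\<Sum>j<4 ^ (n - 1). \<Sum>k<4.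
        cnj (f (x n j)) * g (x n j) * complex_of_real ((cmod (coupling x ta n j k))\<^sup>2))"
      unfolding hinner_def sum_level_Suc[OF lab n]
      by (intro sum.cong refl)
        (simp add: ev[OF that(1), simplified] ev[OF that(2), simplified] complex_norm_square
          del: of_real_power)
    also have "\<dots> = (\<Sum>j<4 ^ (n - 1). cnj (f (x n j)) * g (x n j))"
      by (intro sum.cong refl)
        (simp add: coupling_norm_sum[OF lab uta n] flip: sum_distrib_left of_real_sum
          del: of_real_power)
    finally show ?thesis by (simp add: hinner_def sum_level[OF lab n])
  qed
  have one: "hinner x (n + 1) (U n f) (const_one x (n + 1)) = hinner x n f (const_one x n)"
    if "f \<in> hilb x n" for f
  proof -
    have "hinner x (n + 1) (U n f) (const_one x (n + 1)) = (\<Sum>y\<in>level x (n + 1). cnj (U n f y))"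
      by (simp add: hinner_def const_one_def)
    \<comment> \<open>\<open>hinner\<close> conjugates its first argument, so the conjugated
      couplings appear; their sum is the conjugate of 1.\<close>
    also have "\<dots> = (\<Sum>j<4 ^ (n - 1). \<Sum>k<4. cnj (f (x n j)) * cnj (coupling x ta n j k))"
      unfolding sum_level_Suc[OF lab n]
      by (intro sum.cong refl) (simp add: ev[OF that, simplified])
    also have "\<dots> = (\<Sum>j<4 ^ (n - 1). cnj (f (x n j)))"
      by (intro sum.cong refl)
        (simp add: coupling_sum[OF lab uta n] flip: sum_distrib_left cnj_sum)
    finally show ?thesis by (simp add: hinner_def const_one_def sum_level[OF lab n])
  qed
  have stoch: "stochastic_state x (n + 1) (U n v)" if "stochastic_state x n v" for v
    using that T inner one by (simp add: stochastic_state_def hnorm_def linear_operator_def)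
  have amp: "U n (amplitude_vector x ta n) = amplitude_vector x ta (n + 1)"
  proof (rule hilb_Suc_eqI[OF n])
    show "U n (amplitude_vector x ta n) \<in> hilb x (n + 1)"
      using T amplitude_vector_in_hilb by (auto simp: linear_operator_def)
    fix j k :: nat
    assume jk: "j < 4 ^ (n - 1)" "k < 4"
    then have "4 * j + k < 4 ^ n" using offspring_index_less[OF n] by blast
    \<comment> \<open>Both sides equal the parent's amplitude times the coupling.\<close>
    then show "U n (amplitude_vector x ta n) (x (n + 1) (4 * j + k))
        = amplitude_vector x ta (n + 1) (x (n + 1) (4 * j + k))"
      using ev[OF amplitude_vector_in_hilb jk] amplitude_vector_vertex[OF lab n jk(1)]
        amplitude_vector_vertex[OF lab, of "n + 1"] amplitude_offspring[OF lab n jk]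
      by simp
  qed (rule amplitude_vector_in_hilb)
  have "hadjoint x n (n + 1) (U n) (amplitude_vector x ta (n + 1)) = amplitude_vector x ta n"
  proof (rule hadjoint_eqI)
    \<comment> \<open>Rewriting the vector of level \<open>n + 1\<close> as the image of that of
      level \<open>n\<close> turns the adjoint condition into preservation of inner
      products.\<close>
    show "hinner x n (amplitude_vector x ta n) f
        = hinner x (n + 1) (amplitude_vector x ta (n + 1)) (U n f)" if "f \<in> hilb x n" for f
      unfolding amp[symmetric] by (rule inner[OF amplitude_vector_in_hilb that, symmetric])
  qed (rule amplitude_vector_in_hilb)
  with stoch amp show ?thesis by blast
qed

end
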